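(* In the setting of the context (density $\tilde Z_T$ of the martingale measure, loss function $l$, claim $H$), assume in addition that $l''$ is increasing and that $\mathbf E[l'(H)H]<+\infty$ and $\mathbf E[l''(H)H^2]<+\infty$. Let $v\ge 0$. Then the solution of the problem $$\text{minimize } \tilde{\mathbf E}[e^{-rT}H\varphi]\ \text{ over } \varphi\in\mathcal R \text{ subject to } \mathbf E[l((1-\varphi)H)]\le v$$ is of the form $$\tilde\varphi:=\left\{1-\left(\frac{I(c\tilde Z_T)}{H}\wedge1\right)\right\}\mathbf 1_{\{H>0\}},$$ where $c\ge0$ is such that $\mathbf E[l((1-\tilde\varphi)H)]=v$. (That is, for any such $c$, $\tilde\varphi$ is a minimizer.)
   Context: $(\Omega,\mathcal F,(\mathcal F_t)_{t\in[0,T]},P)$ is a filtered probability space with a $d$-dimensional Wiener process $W$ whose components have positive definite correlation matrix $Q$. With constants $\alpha_i\in\mathbb R$, $\sigma_i>0$ $(i=1,\dots,d)$, $r$, and $\theta=\left(\frac{\alpha_i-r}{\sigma_i}\right)_{i=1}^d$, the measure $\tilde P$ (the martingale measure of the Black–Scholes market $dS^i_t=S^i_t(\alpha_i\,dt+\sigma_i\,dW^i_t)$ with interest rate $r$) is given by $\frac{d\tilde P}{dP}=\tilde Z_T:=\exp\left(-(Q^{-1}\theta,W_T)-\tfrac12|Q^{-1/2}\theta|^2T\right)$. $\mathbf E,\tilde{\mathbf E}$ are expectations under $P,\tilde P$. $\mathcal R:=\{\varphi:\ 0\le\varphi\le1,\ \varphi \text{ is } \mathcal F_T\text{-measurable}\}$.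 $l:[0,\infty)\to[0,\infty)$ is increasing, strictly convex, $l(0)=0$, $l\in C^2(0,\infty)$, $l'$ strictly increasing with $l'(0+)=0$, $l'(+\infty)=+\infty$; $I:=(l')^{-1}$ (with $I(0)=0$). Expressions $l'(H)H$, $l''(H)H^2$ are read as $0$ on $\{H=0\}$. $H\ge0$ is $\mathcal F_T$-measurable with $\mathbf E[e^{-rT}\tilde Z_TH]<\infty$ and $\mathbf E[l(H)]<\infty$. *)

theory Defs
  imports "HOL-Probability.Probability"
begin

definition sym_pos_def :: "real^'n^'n \<Rightarrow> bool" where
  "sym_pos_def A \<longleftrightarrow> transpose A = A \<and> (\<forall>u. u \<noteq> 0 \<longrightarrow> 0 < u \<bullet> (A *v u))"

definition correlation_matrix :: "real^'n^'n \<Rightarrow> bool" where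
  "correlation_matrix Q \<longleftrightarrow> sym_pos_def Q \<and> (\<forall>i. Q $ i $ i = 1)"

(* The exponent -1/2 in the sense of symmetric positive definite matrices: such a square root
   exists and is unique when Q is symmetric positive definite. *)
definition matrix_inv_sqrt :: "real^'n^'n \<Rightarrow> real^'n^'n" where
  "matrix_inv_sqrt Q = (THE R. sym_pos_def R \<and> R ** R = matrix_inv Q)"

(* A filtration indexed by [0,T]; the values of F outside [0,T] are irrelevant. *)
locale filtered_prob_space = prob_space M
  for M :: "'a measure" and F :: "real \<Rightarrow> 'a measure" and T :: real +
  assumes horizon_pos: "0 < T"
    and subalgebra_F: "\<And>t. t \<in> {0..T} \<Longrightarrow> subalgebra M (F t)"
    and sets_F_mono: "\<And>s t. 0 \<le> s \<Longrightarrow> s \<le> t \<Longrightarrow> t \<le> T \<Longrightarrow> sets (F s) \<subseteq> sets (F t)"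

(* Wiener process relative to the filtration F, with W_t - W_s distributed as N(0, (t - s) Q).
   The Gaussian law of the vector is expressed through all its non-zero linear functionals,
   which are non-degenerate since Q is positive definite. *)
locale correlated_wiener_process = filtered_prob_space M F T
  for M :: "'a measure" and F :: "real \<Rightarrow> 'a measure" and T :: real +
  fixes Q :: "real^'n^'n" and W :: "real \<Rightarrow> 'a \<Rightarrow> real^'n"
  assumes correlation_Q: "correlation_matrix Q"
    and W_adapted: "\<And>t. t \<in> {0..T} \<Longrightarrow> W t \<in> borel_measurable (F t)"
    and W_0: "AE \<omega> in M. W 0 \<omega> = 0"
    and W_continuous: "AE \<omega> in M. continuous_on {0..T} (\<lambda>t. W t \<omega>)"
    and W_indep: "\<And>s t. 0 \<le> s \<Longrightarrow> s < t \<Longrightarrow> t \<le> T \<Longrightarrow>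
      indep_set (sets (F s)) {(\<lambda>\<omega>. W t \<omega> - W s \<omega>) -` A \<inter> space M | A. A \<in> sets borel}"
    and W_gaussian: "\<And>s t u. 0 \<le> s \<Longrightarrow> s < t \<Longrightarrow> t \<le> T \<Longrightarrow> u \<noteq> 0 \<Longrightarrow>
      distributed M lborel (\<lambda>\<omega>. u \<bullet> (W t \<omega> - W s \<omega>))
        (\<lambda>x. ennreal (normal_density 0 (sqrt ((t - s) * (u \<bullet> (Q *v u)))) x))"

definition market_price_of_risk :: "real^'n \<Rightarrow> real^'n \<Rightarrow> real \<Rightarrow> real^'n" where
  "market_price_of_risk \<alpha> \<sigma> r = (\<chi> i. (\<alpha> $ i - r) / \<sigma> $ i)"

definition martingale_density ::
  "real \<Rightarrow> real^'n^'n \<Rightarrow> (real \<Rightarrow> 'a \<Rightarrow> real^'n) \<Rightarrow> real^'n \<Rightarrow> real^'n \<Rightarrow> real \<Rightarrow> 'a \<Rightarrow> real" where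
  "martingale_density T Q W \<alpha> \<sigma> r \<omega> =
    (let \<theta> = market_price_of_risk \<alpha> \<sigma> r in
      exp (- ((matrix_inv Q *v \<theta>) \<bullet> W T \<omega>) - 1/2 * (norm (matrix_inv_sqrt Q *v \<theta>))\<^sup>2 * T))"

definition randomized_tests :: "'a measure \<Rightarrow> ('a \<Rightarrow> real) set" where
  "randomized_tests G = {\<phi> \<in> borel_measurable G. \<forall>\<omega>\<in>space G. 0 \<le> \<phi> \<omega> \<and> \<phi> \<omega> \<le> 1}"

definition strictly_convex_on :: "real set \<Rightarrow> (real \<Rightarrow> real) \<Rightarrow> bool" where
  "strictly_convex_on S f \<longleftrightarrow> convex S \<and>
    (\<forall>x\<in>S. \<forall>y\<in>S. \<forall>t\<in>{0<..<1}. x \<noteq> y \<longrightarrow>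
      f ((1 - t) * x + t * y) < (1 - t) * f x + t * f y)"

(* A loss function lives on [0,\<infinity>); its values on negative reals are irrelevant. Derivatives
   are therefore only used on (0,\<infinity>). *)
locale loss_function =
  fixes l :: "real \<Rightarrow> real"
  assumes nonneg: "\<And>x. 0 \<le> x \<Longrightarrow> 0 \<le> l x"
    and zero: "l 0 = 0"
    and increasing: "mono_on {0..} l"
    and strictly_convex: "strictly_convex_on {0..} l"
    and differentiable: "\<And>x. 0 < x \<Longrightarrow> l differentiable (at x)"
    and twice_differentiable: "\<And>x. 0 < x \<Longrightarrow> deriv l differentiable (at x)"
    and continuous_deriv2: "continuous_on {0<..} (deriv (deriv l))"
    and deriv_strict_mono: "strict_mono_on {0<..} (deriv l)"
    and deriv_at_0: "(deriv l \<longlongrightarrow> 0) (at_right 0)"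
    and deriv_at_top: "filterlim (deriv l) at_top at_top"

(* The inverse of the derivative, a bijection of (0,\<infinity>) onto itself, extended by 0 at 0. *)
definition deriv_inverse :: "(real \<Rightarrow> real) \<Rightarrow> real \<Rightarrow> real" where
  "deriv_inverse l y = (if y = 0 then 0 else the_inv_into {0<..} (deriv l) y)"

end

theory Submission
  imports Defs
begin

text \<open>
  Substituting \<open>x = (1 - \<phi>) H\<close>, the problem is to maximize \<open>E[Z x]\<close> over \<open>0 \<le> x \<le> H\<close> subject to
  \<open>E[l(x)] \<le> v\<close>. For fixed \<open>\<omega>\<close> the number \<open>x\<^sup>* = min (I(c Z)) H\<close> minimizes the Lagrangian
  \<open>l(x) - c Z x\<close> over \<open>[0, H]\<close>, because \<open>l\<close> lies above its tangent at \<open>x\<^sup>*\<close>, whose slope is \<open>c Z\<close>,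
  or at most \<open>c Z\<close> when \<open>x\<^sup>* = H\<close>. Integrating gives \<open>c E[Z (x - x\<^sup>*)] \<le> E[l(x)] - v \<le> 0\<close>, which
  settles \<open>c > 0\<close>. If \<open>c = 0\<close> then \<open>x\<^sup>* = 0\<close> and \<open>v = 0\<close>, so that every admissible \<open>x\<close> vanishes
  almost surely.
\<close>

context loss_function
begin

lemma convex_on_loss: "convex_on {0..} l"
proof (rule convex_onI)
  fix t x y :: real
  assume t: "0 < t" "t < 1" and xy: "x \<in> {0..}" "y \<in> {0..}"
  show "l ((1 - t) *\<^sub>R x + t *\<^sub>R y) \<le> (1 - t) * l x + t * l y"
  proof (cases "x = y")
    case True
    then show ?thesis by (simp add: algebra_simps)
  next
    case False
    then show ?thesis
      using strictly_convex t xy unfolding strictly_convex_on_def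
      by (auto intro!: less_imp_le)
  qed
qed simp

text \<open>Convexity on the half-line suffices: \<open>a\<close> is interior, so the two-sided
  derivative there restricts to one within \<open>{0..}\<close>, while \<open>x\<close> may be the
  endpoint 0.\<close>

lemma above_tangent:
  assumes "0 < a" "0 \<le> x"
  shows "deriv l a * (x - a) \<le> l x - l a"
proof (rule convex_on_imp_above_tangent[OF convex_on_loss])
  show "(l has_real_derivative deriv l a) (at a within {0..})"
    using differentiable[OF assms(1)] DERIV_deriv_iff_real_differentiable DERIV_subset
    by blast
qed (use assms in auto)

text \<open>The limit 0 at the origin and monotonicity give only a weak inequality; applying it at
  \<open>x / 2\<close> leaves room for strict growth up to \<open>x\<close>.\<close>

lemma deriv_pos:
  assumes "0 < x"
  shows "0 < deriv l x"
proof -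
  have half: "deriv l (x / 2) < deriv l x"
    using deriv_strict_mono assms by (auto simp: strict_mono_on_def)
  have "\<forall>\<^sub>F y in at_right 0. deriv l y \<le> deriv l (x / 2)"
    using eventually_at_right_real[OF half_gt_zero[OF assms]]
  proof eventually_elim
    case (elim y)
    then show ?case
      using deriv_strict_mono assms by (auto simp: strict_mono_on_def intro!: less_imp_le)
  qed
  then have "0 \<le> deriv l (x / 2)"
    using tendsto_upperbound[OF deriv_at_0] by simp
  with half show ?thesis by simp
qed

text \<open>The tangent at \<open>x / 2\<close> starts from a nonnegative value and has positive
  slope. This lets a vanishing loss force a vanishing shortfall when \<open>c = 0\<close>.\<close>

lemma pos:
  assumes "0 < x"
  shows "0 < l x"
proof -
  have "0 \<le> l (x / 2)" using nonneg assms by simp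
  moreover have "0 < deriv l (x / 2) * (x - x / 2)"
    using deriv_pos[of "x / 2"] assms by simp
  ultimately show ?thesis
    using above_tangent[of "x / 2" x] assms by simp
qed

text \<open>Surjectivity is the intermediate value theorem: the limits at 0 and at infinity supply
  points where the derivative lies below and above a given \<open>y\<close>. Hence
  \<open>deriv_inverse l\<close> is a genuine inverse on positive arguments.\<close>

lemma bij_betw_deriv: "bij_betw (deriv l) {0<..} {0<..}"
proof (rule bij_betw_imageI)
  show "inj_on (deriv l) {0<..}"
    using deriv_strict_mono by (rule strict_mono_on_imp_inj_on)
  have "y \<in> deriv l ` {0<..}" if "0 < y" for y
  proof -
    have "\<forall>\<^sub>F x in at_right 0. deriv l x < y \<and> 0 < x"
      using order_tendstoD(2)[OF deriv_at_0 \<open>0 < y\<close>] eventually_at_right_less[of "0::real"]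
      by eventually_elim simp
    then obtain a where a: "deriv l a < y" "0 < a"
      using eventually_happens' trivial_limit_at_right_real by blast
    have "\<forall>\<^sub>F x in at_top. y < deriv l x \<and> a < x"
      using filterlim_at_top_dense[THEN iffD1, OF deriv_at_top, rule_format, of y]
        eventually_gt_at_top[of a]
      by eventually_elim simp
    then obtain b where b: "y < deriv l b" "a < b"
      using eventually_happens' trivial_limit_at_top_linorder by blast
    have "isCont (deriv l) x" if "0 < x" for x
      using twice_differentiable[OF that] by (rule differentiable_imp_continuous_within)
    then have "\<exists>x\<ge>a. x \<le> b \<and> deriv l x = y"
      using a b by (intro IVT) auto
    then show ?thesis using \<open>0 < a\<close> by force
  qed
  then show "deriv l ` {0<..} = {0<..}" using deriv_pos by auto
qed

lemma deriv_inverse_pos: "0 < y \<Longrightarrow> 0 < deriv_inverse l y"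
  using the_inv_into_into[of "deriv l" "{0<..}" y "{0<..}"] bij_betw_deriv
  by (auto simp: deriv_inverse_def bij_betw_def)

lemma deriv_deriv_inverse: "0 < y \<Longrightarrow> deriv l (deriv_inverse l y) = y"
  using f_the_inv_into_f_bij_betw[OF bij_betw_deriv, of y] by (simp add: deriv_inverse_def)

lemma deriv_inverse_nonneg: "0 \<le> y \<Longrightarrow> 0 \<le> deriv_inverse l y"
  using deriv_inverse_pos[of y] by (cases "y = 0") (auto simp: deriv_inverse_def)

text \<open>Monotonicity is what makes \<open>deriv_inverse l (c * Z \<omega>)\<close> measurable in
  \<open>\<omega>\<close>.\<close>

lemma mono_on_deriv_inverse: "mono_on {0..} (deriv_inverse l)"
proof (rule mono_onI)
  fix x y :: real
  assume xy: "x \<in> {0..}" "y \<in> {0..}" "x \<le> y"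
  show "deriv_inverse l x \<le> deriv_inverse l y"
  proof (cases "x = 0")
    case True
    then show ?thesis using xy deriv_inverse_nonneg[of y] by (simp add: deriv_inverse_def)
  next
    case False
    then have "0 < x" "0 < y" using xy by auto
    then show ?thesis
      using xy deriv_deriv_inverse deriv_inverse_pos strict_mono_onD[OF deriv_strict_mono]
      by (smt (verit) greaterThan_iff)
  qed
qed

end

text \<open>Nothing is known about \<open>f\<close> at negative arguments; precomposing with
  \<open>max 0\<close> yields a function monotone on the whole line, hence Borel, and leaves the
  values along \<open>g\<close> unchanged.\<close>

lemma borel_measurable_mono_on_nonneg:
  fixes f :: "real \<Rightarrow> real"
  assumes "mono_on {0..} f" "g \<in> borel_measurable N"
    and nonneg: "\<And>\<omega>. \<omega> \<in> space N \<Longrightarrow> 0 \<le> g \<omega>"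
  shows "(\<lambda>\<omega>. f (g \<omega>)) \<in> borel_measurable N"
proof -
  have "mono (\<lambda>x. f (max 0 x))"
    using assms(1) by (auto intro!: monoI elim!: mono_onD simp: max_def)
  then have "(\<lambda>x. f (max 0 x)) \<in> borel_measurable borel" by (rule borel_measurable_mono)
  then have "(\<lambda>\<omega>. f (max 0 (g \<omega>))) \<in> borel_measurable N"
    using assms(2) by (rule measurable_compose[rotated])
  then show ?thesis
    by (rule measurable_cong[THEN iffD1, rotated]) (simp add: nonneg max_absorb2)
qed

lemma (in loss_function) truncation_minimizes_lagrangian:
  assumes y: "0 < y" and x: "0 \<le> x" "x \<le> h"
  defines "a \<equiv> min (deriv_inverse l y) h"
  shows "y * (x - a) \<le> l x - l a"
\<comment> \<open>For \<open>h = 0\<close> the truncation point is 0, where no tangent is available,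
  but then \<open>x = 0\<close> too and both sides vanish.\<close>
proof (cases "h = 0")
  case True
  then show ?thesis using x deriv_inverse_pos[OF y] by (simp add: a_def)
next
  case False
  then have a: "0 < a" using x deriv_inverse_pos[OF y] by (simp add: a_def)
  have "y * (x - a) \<le> deriv l a * (x - a)"
  proof (cases "deriv_inverse l y \<le> h")
    case True
    then show ?thesis using deriv_deriv_inverse[OF y] by (simp add: a_def)
  next
    case False
    then have eq: "a = h" and "h < deriv_inverse l y" by (auto simp: a_def)
    then have "deriv l a < y"
      using a strict_mono_onD[OF deriv_strict_mono, of h "deriv_inverse l y"]
        deriv_deriv_inverse[OF y] by simp
    \<comment> \<open>At the cap, \<open>x - a\<close> is nonpositive, so replacing the smaller
      slope \<open>deriv l a\<close> by \<open>y\<close> only lowers the product.\<close>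
    then show ?thesis using x eq by (intro mult_right_mono_neg) auto
  qed
  with above_tangent[OF a x(1)] show ?thesis by simp
qed

lemma (in correlated_wiener_process) martingale_density_measurable:
  "martingale_density T Q W \<alpha> \<sigma> r \<in> borel_measurable (F T)"
proof -
  have [measurable]: "W T \<in> borel_measurable (F T)"
    using W_adapted horizon_pos by simp
  show ?thesis unfolding martingale_density_def[abs_def] Let_def by measurable
qed

text \<open>Since \<open>(1 - \<phi>) H\<close> lies between 0 and \<open>H\<close>, monotonicity
  gives the dominating function \<open>l (H \<omega>)\<close>. Integrability matters because the
  Bochner integral of a nonintegrable function is 0 by default.\<close>

lemma randomized_tests_loss_integrable:
  assumes "loss_function l" "subalgebra M G" "\<phi> \<in> randomized_tests G"
    and H: "H \<in> borel_measurable M" "\<And>\<omega>. \<omega> \<in> space M \<Longrightarrow> 0 \<le> H \<omega>"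
    and int: "integrable M (\<lambda>\<omega>. l (H \<omega>))"
  shows "integrable M (\<lambda>\<omega>. l ((1 - \<phi> \<omega>) * H \<omega>))"
proof (rule Bochner_Integration.integrable_bound[OF int])
  interpret loss_function l by fact
  have \<phi>: "0 \<le> \<phi> \<omega>" "\<phi> \<omega> \<le> 1" if "\<omega> \<in> space M" for \<omega>
    using assms(2,3) that by (auto simp: randomized_tests_def subalgebra_def)
  have [measurable]: "\<phi> \<in> borel_measurable M"
    using assms(2,3) by (auto simp: randomized_tests_def intro: measurable_from_subalg)
  note H(1)[measurable]
  show "(\<lambda>\<omega>. l ((1 - \<phi> \<omega>) * H \<omega>)) \<in> borel_measurable M"
    using increasing by (rule borel_measurable_mono_on_nonneg) (auto simp: \<phi> H(2))
  show "AE \<omega> in M. norm (l ((1 - \<phi> \<omega>) * H \<omega>)) \<le> norm (l (H \<omega>))"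
  proof (rule AE_I2)
    fix \<omega> assume w: "\<omega> \<in> space M"
    have "l ((1 - \<phi> \<omega>) * H \<omega>) \<le> l (H \<omega>)"
      using \<phi>[OF w] H(2)[OF w] by (intro mono_onD[OF increasing]) (auto intro: mult_left_le_one_le)
    then show "norm (l ((1 - \<phi> \<omega>) * H \<omega>)) \<le> norm (l (H \<omega>))"
      using nonneg[of "(1 - \<phi> \<omega>) * H \<omega>"] \<phi>[OF w] H(2)[OF w] by simp
  qed
qed

theorem proposition3p8:
  fixes M :: "'a measure" and F :: "real \<Rightarrow> 'a measure" and T r c v :: real
    and Q :: "real^'n^'n" and W :: "real \<Rightarrow> 'a \<Rightarrow> real^'n" and \<alpha> \<sigma> :: "real^'n"
    and l :: "real \<Rightarrow> real" and H Z \<phi>' :: "'a \<Rightarrow> real" and P' :: "'a measure"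
  assumes wiener: "correlated_wiener_process M F T Q W"
    and sigma_pos: "\<And>i. 0 < \<sigma> $ i"
    and Z: "Z = martingale_density T Q W \<alpha> \<sigma> r"
    and P': "P' = density M (\<lambda>\<omega>. ennreal (Z \<omega>))"
    and loss: "loss_function l"
    and H_measurable: "H \<in> borel_measurable (F T)"
    and H_nonneg: "\<And>\<omega>. \<omega> \<in> space M \<Longrightarrow> 0 \<le> H \<omega>"
    and H_price: "integrable M (\<lambda>\<omega>. exp (- r * T) * Z \<omega> * H \<omega>)"
    and H_loss: "integrable M (\<lambda>\<omega>. l (H \<omega>))"
    and deriv2_increasing: "mono_on {0<..} (deriv (deriv l))"
    and H_deriv: "integrable M (\<lambda>\<omega>. if H \<omega> = 0 then 0 else deriv l (H \<omega>) * H \<omega>)"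
    and H_deriv2: "integrable M (\<lambda>\<omega>. if H \<omega> = 0 then 0 else deriv (deriv l) (H \<omega>) * (H \<omega>)\<^sup>2)"
    and v_nonneg: "0 \<le> v"
    and c_nonneg: "0 \<le> c"
    and phi': "\<phi>' = (\<lambda>\<omega>. (1 - min (deriv_inverse l (c * Z \<omega>) / H \<omega>) 1) * indicator {\<omega>. H \<omega> > 0} \<omega>)"
    and c: "(LINT \<omega>|M. l ((1 - \<phi>' \<omega>) * H \<omega>)) = v"
  shows "is_arg_min (\<lambda>\<phi>. LINT \<omega>|P'. exp (- r * T) * H \<omega> * \<phi> \<omega>)
    (\<lambda>\<phi>. \<phi> \<in> randomized_tests (F T) \<and> (LINT \<omega>|M. l ((1 - \<phi> \<omega>) * H \<omega>)) \<le> v) \<phi>'"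
proof -
  interpret correlated_wiener_process M F T Q W by fact
  interpret loss_function l by fact
  have sub: "subalgebra M (F T)" using subalgebra_F horizon_pos by simp
  have space_F: "space (F T) = space M" using sub by (simp add: subalgebra_def)
  have Z_pos: "0 < Z \<omega>" for \<omega> by (simp add: Z martingale_density_def Let_def)
  have Z_F [measurable]: "Z \<in> borel_measurable (F T)"
    unfolding Z by (rule martingale_density_measurable)
  note H_F [measurable] = H_measurable
  have Z_M [measurable]: "Z \<in> borel_measurable M" and H_M [measurable]: "H \<in> borel_measurable M"
    using sub Z_F H_F by (auto intro: measurable_from_subalg)
  \<comment> \<open>Absorbing the density \<open>Z\<close> moves the cost from \<open>P'\<close> to
    \<open>M\<close>, where the loss constraint lives.\<close>
  define K where "K \<omega> = exp (- r * T) * Z \<omega> * H \<omega>" for \<omega>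
  have K_int: "integrable M K" using H_price by (simp add: K_def[abs_def])

  have phi'_bounds: "0 \<le> \<phi>' \<omega>" "\<phi>' \<omega> \<le> 1" for \<omega>
    using deriv_inverse_nonneg[of "c * Z \<omega>"] Z_pos[of \<omega>] c_nonneg
    by (auto simp: phi' indicator_def)
  \<comment> \<open>The shortfall of the candidate is the pointwise Lagrangian minimizer. Where
    \<open>H \<omega> = 0\<close> both sides are 0, so the quotient in \<open>\<phi>'\<close> does
    no harm.\<close>
  have truncated: "(1 - \<phi>' \<omega>) * H \<omega> = min (deriv_inverse l (c * Z \<omega>)) (H \<omega>)"
    if "\<omega> \<in> space M" for \<omega>
    using H_nonneg[OF that] deriv_inverse_nonneg[of "c * Z \<omega>"] Z_pos[of \<omega>] c_nonneg
    by (auto simp: phi' indicator_def min_def field_simps)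
  have [measurable]: "(\<lambda>\<omega>. deriv_inverse l (c * Z \<omega>)) \<in> borel_measurable (F T)"
    using mono_on_deriv_inverse
    by (rule borel_measurable_mono_on_nonneg) (use c_nonneg Z_pos in \<open>auto simp: less_imp_le\<close>)
  have "(\<lambda>\<omega>. (1 - min (deriv_inverse l (c * Z \<omega>) / H \<omega>) 1) * (if 0 < H \<omega> then 1 else 0))
      \<in> borel_measurable (F T)"
    by measurable
  then have "\<phi>' \<in> borel_measurable (F T)"
    by (simp add: phi' indicator_def of_bool_def)
  then have phi'_test: "\<phi>' \<in> randomized_tests (F T)"
    using phi'_bounds by (simp add: randomized_tests_def)

  have test_bounds: "0 \<le> \<phi> \<omega>" "\<phi> \<omega> \<le> 1"
    if "\<phi> \<in> randomized_tests (F T)" "\<omega> \<in> space M" for \<phi> \<omega>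
    using that by (auto simp: randomized_tests_def space_F)
  have test_M: "\<phi> \<in> borel_measurable M" if "\<phi> \<in> randomized_tests (F T)" for \<phi>
    using that sub by (auto simp: randomized_tests_def intro: measurable_from_subalg)
  have cost: "(LINT \<omega>|P'. exp (- r * T) * H \<omega> * \<phi> \<omega>) = (LINT \<omega>|M. K \<omega> * \<phi> \<omega>)"
    if "\<phi> \<in> randomized_tests (F T)" for \<phi>
  proof -
    note test_M[OF that, measurable]
    show ?thesis
      unfolding P' K_def using Z_pos
      by (subst integral_real_density) (auto intro: less_imp_le simp: mult_ac)
  qed
  have cost_int: "integrable M (\<lambda>\<omega>. K \<omega> * \<phi> \<omega>)" if "\<phi> \<in> randomized_tests (F T)" for \<phi>
  proof (rule Bochner_Integration.integrable_bound[OF K_int])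
    note test_M[OF that, measurable]
    show "(\<lambda>\<omega>. K \<omega> * \<phi> \<omega>) \<in> borel_measurable M" unfolding K_def by measurable
    show "AE \<omega> in M. norm (K \<omega> * \<phi> \<omega>) \<le> norm (K \<omega>)"
      using test_bounds[OF that] by (intro AE_I2) (auto simp: abs_mult mult_left_le)
  qed
  have loss_int: "integrable M (\<lambda>\<omega>. l ((1 - \<phi> \<omega>) * H \<omega>))"
    if "\<phi> \<in> randomized_tests (F T)" for \<phi>
    using loss sub that H_M H_nonneg H_loss by (rule randomized_tests_loss_integrable)

  have "(LINT \<omega>|M. K \<omega> * \<phi>' \<omega>) \<le> (LINT \<omega>|M. K \<omega> * \<phi> \<omega>)"
    if \<phi>: "\<phi> \<in> randomized_tests (F T)" and le: "(LINT \<omega>|M. l ((1 - \<phi> \<omega>) * H \<omega>)) \<le> v" for \<phi>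
  proof (cases "c = 0")
    case False
    then have c_pos: "0 < c" using c_nonneg by simp
    \<comment> \<open>The exponential cancels the discount factor in \<open>K\<close>, so that
      \<open>k * K \<omega>\<close> becomes \<open>c * Z \<omega> * H \<omega>\<close>.\<close>
    define k where "k = c * exp (r * T)"
    have k: "0 < k" using c_pos by (simp add: k_def)
    have "k * (K \<omega> * \<phi>' \<omega> - K \<omega> * \<phi> \<omega>) \<le> l ((1 - \<phi> \<omega>) * H \<omega>) - l ((1 - \<phi>' \<omega>) * H \<omega>)"
      if w: "\<omega> \<in> space M" for \<omega>
    proof -
      have "k * K \<omega> = c * Z \<omega> * H \<omega>"
        by (simp add: k_def K_def mult_ac flip: exp_add)
      then have "k * (K \<omega> * \<phi>' \<omega> - K \<omega> * \<phi> \<omega>)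
          = c * Z \<omega> * ((1 - \<phi> \<omega>) * H \<omega> - (1 - \<phi>' \<omega>) * H \<omega>)"
        by algebra
      also have "\<dots> \<le> l ((1 - \<phi> \<omega>) * H \<omega>) - l ((1 - \<phi>' \<omega>) * H \<omega>)"
        unfolding truncated[OF w] using c_pos Z_pos[of \<omega>] test_bounds[OF \<phi> w] H_nonneg[OF w]
        by (intro truncation_minimizes_lagrangian) (auto intro: mult_left_le_one_le)
      finally show ?thesis .
    qed
    then have "(LINT \<omega>|M. k * (K \<omega> * \<phi>' \<omega> - K \<omega> * \<phi> \<omega>))
        \<le> (LINT \<omega>|M. l ((1 - \<phi> \<omega>) * H \<omega>) - l ((1 - \<phi>' \<omega>) * H \<omega>))"
      using cost_int loss_int phi'_test \<phi>
      by (intro integral_mono Bochner_Integration.integrable_diff integrable_mult_right) auto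
    \<comment> \<open>The candidate spends the loss budget \<open>v\<close> exactly, while
      \<open>\<phi>\<close> spends at most \<open>v\<close>.\<close>
    also have "\<dots> \<le> 0"
      using loss_int[OF \<phi>] loss_int[OF phi'_test] le c by simp
    finally have "k * ((LINT \<omega>|M. K \<omega> * \<phi>' \<omega>) - (LINT \<omega>|M. K \<omega> * \<phi> \<omega>)) \<le> 0"
      using cost_int[OF \<phi>] cost_int[OF phi'_test] by simp
    then show ?thesis using k by (simp add: mult_le_0_iff)
  next
    case True
    \<comment> \<open>A zero multiplier makes the Lagrangian inequality uninformative about cost;
      instead the convention that \<open>deriv_inverse l 0\<close> is 0 makes the candidate a full
      hedge.\<close>
    have no_loss: "(1 - \<phi>' \<omega>) * H \<omega> = 0" if "\<omega> \<in> space M" for \<omega>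
      using truncated[OF that] H_nonneg[OF that] True by (simp add: deriv_inverse_def)
    have "v = (LINT \<omega>|M. 0)"
      unfolding c[symmetric] by (intro Bochner_Integration.integral_cong) (auto simp only: no_loss zero)
    then have "v = 0" by simp
    have nonneg_loss: "0 \<le> l ((1 - \<phi> \<omega>) * H \<omega>)" if "\<omega> \<in> space M" for \<omega>
      using test_bounds[OF \<phi> that] H_nonneg[OF that] by (intro nonneg) simp
    then have "(LINT \<omega>|M. l ((1 - \<phi> \<omega>) * H \<omega>)) = 0"
      using le \<open>v = 0\<close> by (intro antisym integral_nonneg_AE) auto
    then have "AE \<omega> in M. l ((1 - \<phi> \<omega>) * H \<omega>) = 0"
      using nonneg_loss by (subst (asm) integral_nonneg_eq_0_iff_AE[OF loss_int[OF \<phi>]]) auto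
    then have "AE \<omega> in M. K \<omega> * \<phi>' \<omega> = K \<omega> * \<phi> \<omega>"
    proof (rule AE_mp, intro AE_I2 impI)
      fix \<omega> assume w: "\<omega> \<in> space M" and "l ((1 - \<phi> \<omega>) * H \<omega>) = 0"
      then have "(1 - \<phi> \<omega>) * H \<omega> = 0"
        using pos[of "(1 - \<phi> \<omega>) * H \<omega>"] test_bounds[OF \<phi> w] H_nonneg[OF w]
        by (metis diff_ge_0_iff_ge less_eq_real_def mult_nonneg_nonneg order_less_irrefl)
      \<comment> \<open>Either \<open>H \<omega> = 0\<close>, which kills \<open>K \<omega>\<close>,
        or both tests equal 1 at \<open>\<omega>\<close>.\<close>
      with no_loss[OF w] show "K \<omega> * \<phi>' \<omega> = K \<omega> * \<phi> \<omega>" by (auto simp: K_def)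
    qed
    then have "(LINT \<omega>|M. K \<omega> * \<phi>' \<omega>) = (LINT \<omega>|M. K \<omega> * \<phi> \<omega>)"
      using cost_int[OF \<phi>] cost_int[OF phi'_test] by (intro integral_cong_AE) auto
    then show ?thesis by simp
  qed
  then show ?thesis
    using phi'_test c cost by (force simp: is_arg_min_def not_less)
qed

end
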